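(* Let $p$ be a prime with $p\equiv 1\pmod{12}$. Then the permutation polynomial $D_{p+1}(1,x)$ of $\mathbb{F}_p$ has exactly one fixed point in $\mathbb{F}_p$, and each of the permutation polynomials $D_{p+2}(1,x)$ and $D_{2p+1}(1,x)$ of $\mathbb{F}_p$ has exactly $\frac{p+1}{2}$ fixed points in $\mathbb{F}_p$.
   Context: The $n$th reversed Dickson polynomial of the first kind (with parameter $1$) is the integer-coefficient polynomial $D_n(1,x)$ defined by $D_0(1,x)=2$, $D_1(1,x)=1$, $D_n(1,x)=D_{n-1}(1,x)-x\,D_{n-2}(1,x)$ for $n\ge 2$ (equivalently, for $n\geq 1$, $D_n(1,x)=\sum_{i=0}^{\lfloor n/2\rfloor}\frac{n}{n-i}\binom{n-i}{i}(-x)^i$). Coefficients are reduced modulo $p$ to regard it as a polynomial over $\mathbb{F}_p$. A permutation polynomial of $\mathbb{F}_p$ is a polynomial whose associated map $\mathbb{F}_p\to\mathbb{F}_p$ is a bijection. A fixed point of $f$ is an element $c\in\mathbb{F}_p$ with $f(c)=c$. *)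

theory Defs
  imports "Berlekamp_Zassenhaus.Finite_Field"
begin

text \<open>The reversed Dickson polynomial of the first kind \<open>D\<^sub>n(1, x)\<close>, over the integers:
  the first argument is fixed to 1 and the polynomial indeterminate is the parameter \<open>x\<close>.\<close>

fun rev_dickson :: "nat \<Rightarrow> int poly" where
  "rev_dickson 0 = 2"
| "rev_dickson (Suc 0) = 1"
| "rev_dickson (Suc (Suc n)) = rev_dickson (Suc n) - [:0, 1:] * rev_dickson n"

text \<open>Below, \<open>\<F>\<^sub>p\<close> is the type \<open>'p mod_ring\<close> of integers modulo \<open>p = CARD('p)\<close>, so \<open>of_int\<close>
  is reduction modulo \<open>p\<close>.\<close>

definition rev_dickson_mod :: "nat \<Rightarrow> 'p :: prime_card mod_ring poly" where
  "rev_dickson_mod n = of_int_poly (rev_dickson n)"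

definition permutation_poly :: "'a :: field poly \<Rightarrow> bool" where
  "permutation_poly f \<longleftrightarrow> bij (poly f)"

definition fixed_points :: "'a :: field poly \<Rightarrow> 'a set" where
  "fixed_points f = {c. poly f c = c}"

end

theory Submission
  imports Defs
begin

text \<open>If \<open>y\<close> and \<open>1 - y\<close> are the two roots of \<open>t\<^sup>2 - t + x\<close>, then \<open>D\<^sub>n(1, x) = y\<^sup>n + (1 - y)\<^sup>n\<close>. Put
  \<open>d = 1 - 4x\<close>, the discriminant, and write \<open>y = (1 + S) / 2\<close> with \<open>S\<^sup>2 = d\<close>: then \<open>2\<^sup>n D\<^sub>n(1, x)\<close> is
  twice the rational part \<open>a\<close> of \<open>(1 + S)\<^sup>n = a + b S\<close>. The square root \<open>S\<close> is taken to be the class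
  of the indeterminate in \<open>F[S] / (S\<^sup>2 - d)\<close>; this ring need not be a field, so squares and
  non-squares \<open>d\<close> are treated alike and no extension field occurs
  (\<open>rev_dickson_eq_rational_part\<close>).

  Let \<open>e = d\<^bsup>(p-1)/2\<^esup>\<close>, which is \<open>0\<close>, \<open>1\<close> or \<open>-1\<close>. In characteristic \<open>p\<close> one has
  \<open>(1 + S)\<^sup>p = 1 + S\<^sup>p = 1 + e S\<close>, and since \<open>e\<^sup>2 d = d\<close>, multiplying out gives
    \<^item> \<open>2 D\<^bsub>p+1\<^esub> = 1 + e d\<close>,
    \<^item> \<open>4 D\<^bsub>p+2\<^esub> = 4 D\<^bsub>2p+1\<^esub> = 1 + (1 + 2e) d\<close>.

  In the coordinate \<open>d\<close> on the source, these functions are affine images of maps \<open>d \<mapsto> c(e) d\<close>, which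
  scale the squares and the non-squares by the constants \<open>c(1)\<close> and \<open>c(-1)\<close>. Such a map is
  injective as soon as both constants are squares (\<open>inj_quad_char_scaling\<close>). The constants
  that occur are \<open>1\<close>, \<open>-1\<close> and \<open>-3\<close>: \<open>-1\<close> is a square because \<open>p \<equiv> 1 (mod 4)\<close>, and \<open>-3\<close> is one
  because \<open>p \<equiv> 1 (mod 3)\<close>.

  For the fixed points, \<open>D\<^bsub>p+1\<^esub> = x\<close> becomes \<open>(1 + 2e) d = -1\<close>; for \<open>e = -1\<close> this would force
  the square \<open>d = 1\<close>, and for \<open>e = 1\<close> it gives \<open>d = -1/3\<close>, which is indeed a square.
  For the other two polynomials the equation becomes \<open>2 (1 + e) d = 0\<close>, so the fixed points
  correspond to \<open>d = 0\<close> and the \<open>(p - 1) / 2\<close> non-squares.\<close>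

section \<open>Powers modulo a monic quadratic\<close>

lemma rev_dickson_eval_rec:
  fixes x :: "'a :: comm_ring_1"
  shows "poly (of_int_poly (rev_dickson (Suc (Suc n)))) x
       = poly (of_int_poly (rev_dickson (Suc n))) x - x * poly (of_int_poly (rev_dickson n)) x"
  by (simp add: of_int_poly_hom.hom_minus of_int_poly_hom.hom_mult of_int_hom.map_poly_pCons_hom)

definition rational_part :: "'a :: field \<Rightarrow> 'a poly \<Rightarrow> 'a" where
  "rational_part d f = coeff (f mod [:-d, 0, 1:]) 0"

lemma rational_part_linear:
  "rational_part d (f + g) = rational_part d f + rational_part d g"
  "rational_part d (smult c f) = c * rational_part d f"
  by (simp_all add: rational_part_def poly_mod_add_left mod_smult_left)

lemma rational_part_cong:
  assumes "[f = [:a, b:]] (mod [:-d, 0, 1:])"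
  shows "rational_part d f = a"
proof -
  have "[:a, b:] mod [:-d, 0, 1:] = [:a, b:]"
    by (rule mod_poly_less) simp
  with assms show ?thesis
    by (simp add: rational_part_def cong_def)
qed

text \<open>Both sides satisfy the same recurrence: \<open>1 + S\<close> is a root of \<open>t\<^sup>2 - 2t - (d - 1)\<close>, and
  \<open>d - 1 = -4x\<close> turns this into the Dickson recurrence rescaled by powers of 2.\<close>

lemma rev_dickson_eq_rational_part:
  fixes x d :: "'a :: field_gcd"
  assumes d: "d = 1 - 4 * x"
  shows "2 ^ n * poly (of_int_poly (rev_dickson n)) x = 2 * rational_part d ([:1, 1:] ^ n)"
proof (induction n rule: rev_dickson.induct)
  case 1
  have "rational_part d 1 = 1"
    by (rule rational_part_cong[where b = 0]) (simp add: one_pCons)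
  moreover have "of_int_poly (2 :: int poly) = (2 :: 'a poly)"
    using of_int_poly_hom.hom_numeral[of "num.Bit0 num.One"] .
  ultimately show ?case by simp
next
  case 2
  have "rational_part d [:1, 1:] = 1"
    by (rule rational_part_cong[where b = 1]) simp
  then show ?case by simp
next
  case (3 n)
  let ?u = "[:1, 1:] :: 'a poly" and ?D = "\<lambda>n. poly (of_int_poly (rev_dickson n)) x"
  have "?u ^ Suc (Suc n) - (smult 2 (?u ^ Suc n) + smult (d - 1) (?u ^ n)) = [:-d, 0, 1:] * ?u ^ n"
  proof -
    have "?u * ?u - smult 2 ?u - smult (d - 1) 1 = [:-d, 0, 1:]"
      by (simp add: one_pCons)
    then have "(?u * ?u - smult 2 ?u - smult (d - 1) 1) * ?u ^ n = [:-d, 0, 1:] * ?u ^ n"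
      by (simp only:)
    then show ?thesis
      by (simp only: left_diff_distrib distrib_right mult_smult_left mult_1 power_Suc mult.assoc diff_diff_eq)
  qed
  then have "?u ^ Suc (Suc n) mod [:-d, 0, 1:]
      = (smult 2 (?u ^ Suc n) + smult (d - 1) (?u ^ n)) mod [:-d, 0, 1:]"
    by (metis dvd_triv_left mod_eq_dvd_iff)
  then have "rational_part d (?u ^ Suc (Suc n))
      = 2 * rational_part d (?u ^ Suc n) + (d - 1) * rational_part d (?u ^ n)"
    by (metis rational_part_def rational_part_linear)
  then have step: "rational_part d (?u ^ Suc (Suc n))
      = 2 * rational_part d (?u ^ Suc n) - 4 * x * rational_part d (?u ^ n)"
    using d by simp
  have "2 * rational_part d (?u ^ Suc (Suc n))
      = 2 * (2 * rational_part d (?u ^ Suc n)) - 4 * x * (2 * rational_part d (?u ^ n))"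
    unfolding step right_diff_distrib by (simp only: mult_ac)
  also have "\<dots> = 2 * (2 ^ Suc n * ?D (Suc n)) - 4 * x * (2 ^ n * ?D n)"
    by (simp only: 3)
  also have "\<dots> = 2 ^ Suc (Suc n) * ?D (Suc (Suc n))"
    unfolding rev_dickson_eval_rec by (simp add: algebra_simps)
  finally show ?case by simp
qed

section \<open>The quadratic character\<close>

text \<open>The quadratic character is taken in Euler's form. It is multiplicative by definition, and
  its values can be counted by bounding roots of polynomials.\<close>

definition quad_char :: "'a :: finite_field \<Rightarrow> 'a" where
  "quad_char d = d ^ ((CARD('a) - 1) div 2)"

lemma card_nth_power_roots_le:
  fixes c :: "'a :: idom"
  assumes "k > 0"
  shows "card {x :: 'a. x ^ k = c} \<le> k"
proof -
  let ?f = "monom 1 k - [:c:]"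
  have deg: "degree ?f = k"
    using degree_add_eq_left[of "- [:c:]" "monom 1 k"] assms
    by (simp add: degree_monom_eq del: minus_pCons)
  then have "?f \<noteq> 0" using assms by auto
  from card_poly_roots_bound[OF this] deg show ?thesis
    by (simp add: poly_monom)
qed

lemma nonzero_power_card_minus_1:
  fixes x :: "'a :: finite_field"
  assumes "x \<noteq> 0"
  shows "x ^ (CARD('a) - 1) = 1"
  using assms finite_field_power_card_eq_same[of x]
  by (metis One_nat_def Suc_pred mult_cancel_left2 power_Suc zero_less_card_finite)

lemma quad_char_mult: "quad_char (a * b) = quad_char a * quad_char b"
  by (simp add: quad_char_def power_mult_distrib)

lemma quad_char_1 [simp]: "quad_char 1 = 1"
  by (simp add: quad_char_def)

text \<open>If \<open>q\<close> were even, \<open>x\<^sup>q = x\<close> at \<open>x = -1\<close> would say \<open>1 = -1\<close>.\<close>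

lemma odd_card_if_two_nonzero:
  assumes "(2 :: 'a :: finite_field) \<noteq> 0"
  shows "odd CARD('a)"
proof
  assume "even CARD('a)"
  then have "(- 1 :: 'a) = 1"
    using finite_field_power_card_eq_same[of "- 1 :: 'a"] by simp
  then have "(2 :: 'a) = 0"
    by (metis add.right_inverse one_add_one)
  with assms show False by contradiction
qed

lemma card_ge_3_if_two_nonzero:
  assumes "(2 :: 'a :: finite_field) \<noteq> 0"
  shows "CARD('a) \<ge> 3"
proof -
  have "card {0, 1 :: 'a} \<le> CARD('a)"
    by (intro card_mono) auto
  with odd_card_if_two_nonzero[OF assms] show ?thesis
    by (cases "CARD('a) = 2") auto
qed

lemma quad_char_squared:
  assumes "(2 :: 'a :: finite_field) \<noteq> 0" and "x \<noteq> 0"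
  shows "quad_char x ^ 2 = (1 :: 'a)"
  using nonzero_power_card_minus_1[OF assms(2)] odd_card_if_two_nonzero[OF assms(1)]
  by (simp add: quad_char_def flip: power_mult)

lemma quad_char_square:
  assumes "(2 :: 'a :: finite_field) \<noteq> 0" and "x \<noteq> 0"
  shows "quad_char (x ^ 2) = (1 :: 'a)"
  using quad_char_squared[OF assms] by (simp add: quad_char_def power2_eq_square power_mult_distrib)

lemma quad_char_eq_0_iff:
  assumes "(2 :: 'a :: finite_field) \<noteq> 0"
  shows "quad_char x = 0 \<longleftrightarrow> x = (0 :: 'a)"
  using card_ge_3_if_two_nonzero[OF assms] by (auto simp: quad_char_def)

lemma quad_char_cases:
  fixes d :: "'a :: finite_field"
  assumes "(2 :: 'a) \<noteq> 0"
  obtains "d = 0" "quad_char d = 0" | "d \<noteq> 0" "quad_char d = 1" | "d \<noteq> 0" "quad_char d = -1"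
  using quad_char_squared[OF assms, of d] quad_char_eq_0_iff[OF assms, of d]
  by (auto simp: power2_eq_1_iff)

text \<open>Each of the values \<open>1\<close> and \<open>-1\<close> is taken at most \<open>(q - 1) / 2\<close> times, by the degree bound on the
  number of roots, and together they account for all \<open>q - 1\<close> nonzero elements.\<close>

lemma card_quad_char_eq_minus_1:
  assumes two: "(2 :: 'a :: finite_field) \<noteq> 0"
  shows "card {d :: 'a. quad_char d = -1} = (CARD('a) - 1) div 2"
proof -
  let ?k = "(CARD('a) - 1) div 2"
  let ?P = "{d :: 'a. quad_char d = 1}" and ?N = "{d :: 'a. quad_char d = -1}"
  have k: "?k > 0" "2 * ?k = CARD('a) - 1"
    using card_ge_3_if_two_nonzero[OF two] odd_card_if_two_nonzero[OF two] by auto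
  have "- 1 \<noteq> (1 :: 'a)"
    using two by (metis add.right_inverse one_add_one)
  then have "?P \<inter> ?N = {}" by auto
  moreover have "?P \<union> ?N = UNIV - {0}"
    using quad_char_squared[OF two] quad_char_eq_0_iff[OF two, of 0]
    by (auto simp: power2_eq_1_iff)
  ultimately have "card ?P + card ?N = CARD('a) - 1"
    by (metis (no_types, lifting) card_Diff_singleton card_Un_disjoint finite UNIV_I)
  moreover have "card ?P \<le> ?k" "card ?N \<le> ?k"
    using card_nth_power_roots_le[OF k(1)] by (auto simp: quad_char_def)
  ultimately show ?thesis using k(2) by linarith
qed

lemma quad_char_minus_1:
  assumes "4 dvd CARD('a :: finite_field) - 1"
  shows "quad_char (- 1 :: 'a) = 1"
proof -
  have "even ((CARD('a) - 1) div 2)"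
    using assms by (auto elim!: dvdE)
  then show ?thesis by (simp add: quad_char_def)
qed

text \<open>A primitive cube root of unity \<open>w\<close> gives the square root \<open>2w + 1\<close> of \<open>-3\<close>.\<close>

lemma quad_char_minus_3:
  assumes two: "(2 :: 'a :: finite_field) \<noteq> 0" and three: "(3 :: 'a) \<noteq> 0"
    and dvd: "3 dvd CARD('a) - 1"
  shows "quad_char (- 3 :: 'a) = 1"
proof -
  define k where "k = (CARD('a) - 1) div 3"
  have k: "3 * k = CARD('a) - 1" "k > 0"
    using dvd card_ge_3_if_two_nonzero[OF two] by (auto simp: k_def)
  \<comment> \<open>Not every nonzero \<open>x\<close> has \<open>x\<^sup>k = 1\<close>, since only \<open>k < q - 1\<close> elements can; any other \<open>x\<close> yields
    the cube root of unity \<open>w = x\<^sup>k\<close>.\<close>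
  have "\<not> UNIV - {0 :: 'a} \<subseteq> {x. x ^ k = 1}"
  proof
    assume "UNIV - {0 :: 'a} \<subseteq> {x. x ^ k = 1}"
    then have "card (UNIV - {0 :: 'a}) \<le> card {x :: 'a. x ^ k = 1}"
      by (intro card_mono) auto
    then have "3 * k \<le> k"
      using card_nth_power_roots_le[OF k(2), of "1 :: 'a"] k(1) by (simp add: card_Diff_singleton)
    with k(2) show False by simp
  qed
  then obtain x :: 'a where x: "x \<noteq> 0" "x ^ k \<noteq> 1" by auto
  define w where "w = x ^ k"
  have "w ^ 3 = 1"
    using nonzero_power_card_minus_1[OF x(1)] k(1) by (simp add: w_def mult.commute flip: power_mult)
  then have "(w - 1) * (w ^ 2 + w + 1) = 0"
    by (simp add: algebra_simps power2_eq_square power3_eq_cube)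
  then have "w ^ 2 + w + 1 = 0"
    using x(2) by (simp add: w_def)
  moreover have "(2 * w + 1) ^ 2 + 3 = 4 * (w ^ 2 + w + 1)"
    by (simp add: algebra_simps power2_eq_square)
  ultimately have root: "(2 * w + 1) ^ 2 = - 3"
    by (simp add: add_eq_0_iff2)
  then have "2 * w + 1 \<noteq> 0"
    using three by auto
  from quad_char_square[OF two this] root show ?thesis by simp
qed

text \<open>The conditions on \<open>c\<close> make the map preserve the quadratic character, so the scaling factor
  can be recovered from the image.\<close>

lemma inj_quad_char_scaling:
  fixes c :: "'a :: finite_field \<Rightarrow> 'a"
  assumes two: "(2 :: 'a) \<noteq> 0"
    and c: "quad_char (c 1) = 1" "quad_char (c (- 1)) = 1"
  shows "inj (\<lambda>d. c (quad_char d) * d)"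
proof (rule injI)
  fix d d' :: 'a
  assume eq: "c (quad_char d) * d = c (quad_char d') * d'"
  have pres: "quad_char (c (quad_char d) * d) = quad_char d" for d
    by (cases rule: quad_char_cases[OF two, of d]) (simp_all add: quad_char_mult c)
  from eq have e: "quad_char d = quad_char d'"
    by (metis pres)
  show "d = d'"
  proof (cases "d = 0")
    case True
    then show ?thesis
      using e quad_char_eq_0_iff[OF two] by metis
  next
    case False
    then have "quad_char d = 1 \<or> quad_char d = - 1"
      using quad_char_squared[OF two] by (metis power2_eq_1_iff)
    then have "quad_char (c (quad_char d)) = 1"
      using c by metis
    then have "c (quad_char d) \<noteq> 0"
      using quad_char_eq_0_iff[OF two] by (metis zero_neq_one)
    with eq show ?thesis
      unfolding e by (metis mult_left_cancel)
  qed
qed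

section \<open>The values of the three polynomials\<close>

text \<open>This is the Frobenius map at work: \<open>(1 + S)\<^sup>p = 1 + S\<^sup>p\<close>, and \<open>S\<^sup>p = (S\<^sup>2)\<^bsup>(p-1)/2\<^esup> S\<close> with
  \<open>S\<^sup>2 = d\<close>.\<close>

lemma power_card_mod_quadratic:
  fixes d :: "'p :: prime_card mod_ring"
  assumes two: "(2 :: 'p mod_ring) \<noteq> 0"
  shows "[[:1, 1:] ^ CARD('p) = [:1, quad_char d:]] (mod [:-d, 0, 1:])"
proof -
  let ?S = "[:0, 1:] :: 'p mod_ring poly" and ?k = "(CARD('p) - 1) div 2"
  have p: "CARD('p) = 2 * ?k + 1"
    using odd_card_if_two_nonzero[OF two] by simp
  have "[:1, 1:] ^ CARD('p) = (1 + ?S) ^ CARD('p)"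
    by (simp add: one_pCons)
  also have "\<dots> = 1 + ?S ^ CARD('p)"
    using prime_card[where 'a = 'p] by (subst freshmans_dream) simp_all
  also have "?S ^ CARD('p) = (?S ^ 2) ^ ?k * ?S"
    by (subst p) (simp add: power_mult)
  finally have "[:1, 1:] ^ CARD('p) = 1 + (?S ^ 2) ^ ?k * ?S" .
  moreover have "[?S ^ 2 = [:d:]] (mod [:-d, 0, 1:])"
    by (simp add: cong_iff_dvd_diff power2_eq_square)
  then have "[1 + (?S ^ 2) ^ ?k * ?S = 1 + [:d:] ^ ?k * ?S] (mod [:-d, 0, 1:])"
    by (intro cong_add cong_mult cong_pow) simp_all
  moreover have "1 + [:d:] ^ ?k * ?S = [:1, quad_char d:]"
    by (simp add: quad_char_def poly_const_pow one_pCons)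
  ultimately show ?thesis by simp
qed

context
  fixes x d :: "'p :: prime_card mod_ring"
  assumes two: "(2 :: 'p mod_ring) \<noteq> 0" and d: "d = 1 - 4 * x"
begin

lemma two_power: "(2 :: 'p mod_ring) ^ CARD('p) = 2"
  using finite_field_power_card_eq_same[of "2 :: 'p mod_ring"] by simp

lemma poly_rev_dickson_mod_eqI:
  assumes "[[:1, 1:] ^ n = f] (mod [:-d, 0, 1:])" and "[f = [:a, b:]] (mod [:-d, 0, 1:])"
  shows "2 ^ n * poly (rev_dickson_mod n) x = 2 * a"
  using rev_dickson_eq_rational_part[OF d, of n] rational_part_cong[OF cong_trans[OF assms]]
  by (simp add: rev_dickson_mod_def)

lemma rev_dickson_mod_card_plus_1:
  "2 * poly (rev_dickson_mod (CARD('p) + 1)) x = 1 + quad_char d * d"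
proof -
  let ?e = "quad_char d"
  have "[[:1, 1:] ^ (CARD('p) + 1) = [:1, ?e:] * [:1, 1:]] (mod [:-d, 0, 1:])"
    using cong_mult[OF power_card_mod_quadratic[OF two] cong_refl[of "[:1, 1:]"]]
    by (simp only: power_add power_one_right)
  \<comment> \<open>The divisibility witness is the quotient of the product by \<open>S\<^sup>2 - d\<close>.\<close>
  moreover have "[[:1, ?e:] * [:1, 1:] = [:1 + ?e * d, 1 + ?e:]] (mod [:-d, 0, 1:])"
    by (auto simp: cong_iff_dvd_diff intro!: dvdI[of _ _ "[:?e:]"])
  ultimately have "2 ^ (CARD('p) + 1) * poly (rev_dickson_mod (CARD('p) + 1)) x = 2 * (1 + ?e * d)"
    by (rule poly_rev_dickson_mod_eqI)
  then have "2 * (2 * poly (rev_dickson_mod (CARD('p) + 1)) x) = 2 * (1 + ?e * d)"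
    by (simp only: power_add power_one_right two_power mult.assoc)
  then show ?thesis
    using mult_left_cancel[OF two] by blast
qed

lemma rev_dickson_mod_card_plus_2:
  "4 * poly (rev_dickson_mod (CARD('p) + 2)) x = 1 + (1 + 2 * quad_char d) * d"
proof -
  let ?e = "quad_char d"
  have "[[:1, 1:] ^ (CARD('p) + 2) = [:1, ?e:] * [:1, 1:] ^ 2] (mod [:-d, 0, 1:])"
    using cong_mult[OF power_card_mod_quadratic[OF two] cong_refl[of "[:1, 1:] ^ 2"]]
    by (simp only: power_add)
  \<comment> \<open>The divisibility witness is the quotient of the product by \<open>S\<^sup>2 - d\<close>.\<close>
  moreover have "[[:1, ?e:] * [:1, 1:] ^ 2 = [:1 + (1 + 2 * ?e) * d, 2 + ?e * (1 + d):]] (mod [:-d, 0, 1:])"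
    by (auto simp: cong_iff_dvd_diff power2_eq_square algebra_simps intro!: dvdI[of _ _ "[:1 + 2 * ?e, ?e:]"])
  ultimately have "2 ^ (CARD('p) + 2) * poly (rev_dickson_mod (CARD('p) + 2)) x
      = 2 * (1 + (1 + 2 * ?e) * d)"
    by (rule poly_rev_dickson_mod_eqI)
  then have "2 * (4 * poly (rev_dickson_mod (CARD('p) + 2)) x) = 2 * (1 + (1 + 2 * ?e) * d)"
    by (simp add: power_add two_power del: add_2_eq_Suc')
  then show ?thesis
    using mult_left_cancel[OF two] by blast
qed

lemma rev_dickson_mod_twice_card_plus_1:
  "4 * poly (rev_dickson_mod (2 * CARD('p) + 1)) x = 1 + (1 + 2 * quad_char d) * d"
proof -
  let ?e = "quad_char d"
  have e: "?e ^ 2 * d = d"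
    by (cases rule: quad_char_cases[OF two, of d]) simp_all
  have "[[:1, 1:] ^ (2 * CARD('p) + 1) = [:1, ?e:] ^ 2 * [:1, 1:]] (mod [:-d, 0, 1:])"
    using cong_mult[OF cong_pow[OF power_card_mod_quadratic[OF two], of 2] cong_refl[of "[:1, 1:]"]]
    by (simp only: mult.commute[of 2] power_add power_mult power_one_right)
  \<comment> \<open>The divisibility witness is the quotient of the product by \<open>S\<^sup>2 - d\<close>.\<close>
  moreover have "[[:1, ?e:] ^ 2 * [:1, 1:] = [:1 + (?e ^ 2 + 2 * ?e) * d, 1 + 2 * ?e + ?e ^ 2 * d:]] (mod [:-d, 0, 1:])"
    by (auto simp: cong_iff_dvd_diff power2_eq_square algebra_simps intro!: dvdI[of _ _ "[:?e ^ 2 + 2 * ?e, ?e ^ 2:]"])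
  ultimately have "2 ^ (2 * CARD('p) + 1) * poly (rev_dickson_mod (2 * CARD('p) + 1)) x
      = 2 * (1 + (?e ^ 2 + 2 * ?e) * d)"
    by (rule poly_rev_dickson_mod_eqI)
  moreover have "1 + (?e ^ 2 + 2 * ?e) * d = 1 + (1 + 2 * ?e) * d"
    using e by (simp add: distrib_right)
  moreover have "2 ^ (2 * CARD('p) + 1) = (2 * 4 :: 'p mod_ring)"
    by (simp add: mult.commute[of 2] power_mult two_power)
  ultimately have "2 * (4 * poly (rev_dickson_mod (2 * CARD('p) + 1)) x) = 2 * (1 + (1 + 2 * ?e) * d)"
    by (simp only: mult.assoc)
  then show ?thesis
    using mult_left_cancel[OF two] by blast
qed

end

section \<open>Permutation property and fixed points\<close>

lemma four_nonzero:
  assumes "(2 :: 'a :: idom) \<noteq> 0"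
  shows "(4 :: 'a) \<noteq> 0"
proof -
  have "(4 :: 'a) = 2 * 2" by simp
  with assms show ?thesis by (metis mult_eq_0_iff)
qed

lemma bij_discriminant:
  assumes "(2 :: 'a :: finite_field) \<noteq> 0"
  shows "bij (\<lambda>x :: 'a. 1 - 4 * x)"
proof -
  have "inj (\<lambda>x :: 'a. 1 - 4 * x)"
    using four_nonzero[OF assms] by (auto intro!: injI)
  then show ?thesis
    by (simp add: bij_def finite_UNIV_inj_surj)
qed

lemma bij_if_inj_affine_conjugate:
  fixes f k :: "'a :: finite_field \<Rightarrow> 'a"
  assumes "(2 :: 'a) \<noteq> 0" and "inj k"
    and "\<And>x. a + b * f x = k (1 - 4 * x)"
  shows "bij f"
proof -
  have "inj f"
  proof (rule injI)
    fix x y assume "f x = f y"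
    then have "k (1 - 4 * x) = k (1 - 4 * y)"
      by (metis assms(3))
    then show "x = y"
      using injD[OF assms(2)] four_nonzero[OF assms(1)] by fastforce
  qed
  then show ?thesis
    by (simp add: bij_def finite_UNIV_inj_surj)
qed

text \<open>In terms of \<open>d = 1 - 4x\<close>, the equation \<open>f x = x\<close> reads \<open>2 (1 + e) d = 0\<close>, where \<open>e\<close> is the
  quadratic character of \<open>d\<close>.\<close>

lemma card_fixed_points_half:
  fixes f :: "'a :: finite_field \<Rightarrow> 'a"
  assumes two: "(2 :: 'a) \<noteq> 0"
    and f: "\<And>x. 4 * f x = 1 + (1 + 2 * quad_char (1 - 4 * x)) * (1 - 4 * x)"
  shows "card {x. f x = x} = (CARD('a) + 1) div 2"
proof -
  note four = four_nonzero[OF two]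
  let ?g = "\<lambda>x :: 'a. 1 - 4 * x"
  have "f x = x \<longleftrightarrow> ?g x = 0 \<or> quad_char (?g x) = - 1" for x
  proof -
    have "f x = x \<longleftrightarrow> 4 * f x = 4 * x"
      using four by simp
    also have "4 * x = 1 - ?g x" by simp
    also have "4 * f x = 1 - ?g x \<longleftrightarrow> 2 * ((1 + quad_char (?g x)) * ?g x) = 0"
      unfolding f by (auto simp: algebra_simps)
    also have "\<dots> \<longleftrightarrow> ?g x = 0 \<or> quad_char (?g x) = - 1"
      using two by (auto simp: add_eq_0_iff)
    finally show ?thesis .
  qed
  then have "{x. f x = x} = ?g -` insert 0 {d. quad_char d = - 1}"
    by (simp only: vimage_def insert_iff mem_Collect_eq)
  moreover have "bij ?g"
    by (rule bij_discriminant[OF two])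
  ultimately have "card {x. f x = x} = card (insert 0 {d :: 'a. quad_char d = - 1})"
    by (simp add: card_vimage_inj bij_def)
  also have "\<dots> = Suc ((CARD('a) - 1) div 2)"
    using quad_char_eq_0_iff[OF two, of 0] by (simp add: card_quad_char_eq_minus_1[OF two])
  also have "\<dots> = (CARD('a) + 1) div 2"
    using odd_card_if_two_nonzero[OF two] by (auto elim!: oddE)
  finally show ?thesis .
qed

theorem theorem3p7:
  fixes p :: nat
  assumes "prime p"
    and "[p = 1] (mod 12)"
    and "CARD('p :: prime_card) = p"
  shows "permutation_poly (rev_dickson_mod (p + 1) :: 'p mod_ring poly)
       \<and> card (fixed_points (rev_dickson_mod (p + 1) :: 'p mod_ring poly)) = 1
       \<and> permutation_poly (rev_dickson_mod (p + 2) :: 'p mod_ring poly)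
       \<and> card (fixed_points (rev_dickson_mod (p + 2) :: 'p mod_ring poly)) = (p + 1) div 2
       \<and> permutation_poly (rev_dickson_mod (2 * p + 1) :: 'p mod_ring poly)
       \<and> card (fixed_points (rev_dickson_mod (2 * p + 1) :: 'p mod_ring poly)) = (p + 1) div 2"
proof -
  have "p mod 12 = 1"
    using assms(2) by (simp add: cong_def)
  then have dvd: "12 dvd p - 1"
    by presburger
  have ge: "p \<ge> 13"
    using dvd_imp_le[OF dvd] prime_gt_1_nat[OF assms(1)] by simp
  have char: "CARD('p mod_ring) = p"
    using assms(3) by simp
  have two: "(2 :: 'p mod_ring) \<noteq> 0"
    using of_nat_0_mod_ring_dvd[where 'a = 'p, of 2] dvd_imp_le[of p 2] ge assms(3) by auto
  have three: "(3 :: 'p mod_ring) \<noteq> 0"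
    using of_nat_0_mod_ring_dvd[where 'a = 'p, of 3] dvd_imp_le[of p 3] ge assms(3) by auto
  note four = four_nonzero[OF two]
  have qm1: "quad_char (- 1 :: 'p mod_ring) = 1"
    using dvd_trans[OF _ dvd, of 4] by (intro quad_char_minus_1) (simp add: assms(3))
  have qm3: "quad_char (- 3 :: 'p mod_ring) = 1"
    using dvd_trans[OF _ dvd, of 3] by (intro quad_char_minus_3 two three) (simp add: assms(3))

  let ?f = "\<lambda>n. poly (rev_dickson_mod n :: 'p mod_ring poly)"
  have f1: "2 * ?f (p + 1) x = 1 + quad_char (1 - 4 * x) * (1 - 4 * x)" for x
    using rev_dickson_mod_card_plus_1[OF two refl, of x] by (simp add: assms(3))
  have f2: "4 * ?f (p + 2) x = 1 + (1 + 2 * quad_char (1 - 4 * x)) * (1 - 4 * x)" for x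
    using rev_dickson_mod_card_plus_2[OF two refl, of x] by (simp add: assms(3))
  have f3: "4 * ?f (2 * p + 1) x = 1 + (1 + 2 * quad_char (1 - 4 * x)) * (1 - 4 * x)" for x
    using rev_dickson_mod_twice_card_plus_1[OF two refl, of x] by (simp add: assms(3))

  \<comment> \<open>The affine changes on the target are chosen so that the constant term vanishes and the
    scaling factors become squares: \<open>2 D - 1\<close> already works for the first polynomial, while
    \<open>1 - 4 D\<close>, the same change as on the source, gives the factors \<open>-3\<close> and \<open>1\<close> for the other two.\<close>
  have "inj (\<lambda>d :: 'p mod_ring. quad_char d * d)"
    using inj_quad_char_scaling[OF two, of "\<lambda>e. e"] qm1 by simp
  then have bij1: "bij (?f (p + 1))"
    by (rule bij_if_inj_affine_conjugate[OF two, where a = "- 1" and b = 2]) (simp only: f1, simp)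
  have inj: "inj (\<lambda>d :: 'p mod_ring. - (1 + 2 * quad_char d) * d)"
    using qm3 by (intro inj_quad_char_scaling[OF two, of "\<lambda>e. - (1 + 2 * e)"]) simp_all
  have bij2: "bij (?f (p + 2))"
    by (rule bij_if_inj_affine_conjugate[OF two inj, where a = 1 and b = "- 4"])
      (simp only: mult_minus_left f2, simp)
  have bij3: "bij (?f (2 * p + 1))"
    by (rule bij_if_inj_affine_conjugate[OF two inj, where a = 1 and b = "- 4"])
      (simp only: mult_minus_left f3, simp)

  have fix1: "?f (p + 1) x = x \<longleftrightarrow> 3 * x = 1" for x
  proof -
    define d where "d = 1 - 4 * x"
    have "?f (p + 1) x = x \<longleftrightarrow> 2 * (2 * ?f (p + 1) x) = 4 * x"
      using four by simp
    also have "4 * x = 1 - d" by (simp add: d_def)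
    also have "2 * (2 * ?f (p + 1) x) = 2 * (1 + quad_char d * d)"
      by (simp only: f1 d_def)
    also have "2 * (1 + quad_char d * d) = 1 - d \<longleftrightarrow> (1 + 2 * quad_char d) * d = - 1"
      by (auto simp: algebra_simps eq_neg_iff_add_eq_0)
    also have "\<dots> \<longleftrightarrow> (- 3) * d = 1"
    proof
      assume eq: "(1 + 2 * quad_char d) * d = - 1"
      show "(- 3) * d = 1"
      proof (cases rule: quad_char_cases[OF two, of d])
        case 1
        with eq show ?thesis by simp
      next
        case 2
        with eq show ?thesis by (simp add: minus_equation_iff)
      next
        case 3
        \<comment> \<open>The equation would make \<open>d\<close> equal to the square 1, although its character is \<open>-1\<close>.\<close>
        with eq have "d = 1" by simp
        with 3 have "(2 :: 'p mod_ring) = 0" by (metis add.right_inverse one_add_one quad_char_1)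
        with two show ?thesis by contradiction
      qed
    next
      assume eq: "(- 3) * d = 1"
      then have "quad_char (- 3) * quad_char d = 1"
        by (metis quad_char_1 quad_char_mult)
      with eq qm3 show "(1 + 2 * quad_char d) * d = - 1"
        by (simp add: minus_equation_iff)
    qed
    also have "\<dots> \<longleftrightarrow> 4 * (3 * x) = 4 * 1"
      by (auto simp: d_def algebra_simps)
    also have "\<dots> \<longleftrightarrow> 3 * x = 1"
      using mult_left_cancel[OF four] by blast
    finally show ?thesis .
  qed
  have "3 * x = 1 \<longleftrightarrow> x = 1 / 3" for x :: "'p mod_ring"
    using three by (simp add: eq_divide_eq mult.commute)
  then have "{x. ?f (p + 1) x = x} = {1 / 3}"
    by (simp only: fix1 singleton_conv)
  then have "card {x. ?f (p + 1) x = x} = 1" by simp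
  moreover have "card {x. ?f (p + 2) x = x} = (p + 1) div 2"
    using card_fixed_points_half[OF two f2] char by simp
  moreover have "card {x. ?f (2 * p + 1) x = x} = (p + 1) div 2"
    using card_fixed_points_half[OF two f3] char by simp
  ultimately show ?thesis
    using bij1 bij2 bij3 by (simp add: permutation_poly_def fixed_points_def)
qed

end
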